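(* Let $a\in\mathbb{R}$, $n\in\mathbb{Z}_+$, $\alpha>0$, and let $w:\mathbb{N}_a\to\mathbb{R}\setminus\{0\}$ satisfy $\frac{w(a)}{w(k)}>0$ for all $k\in\mathbb{N}_{a+1}$. Let $\mathbb{D}\subseteq\mathbb{R}^n$ be a convex set, $f:\mathbb{D}\to\mathbb{R}$ convex, and $x:\mathbb{N}_{a+1}\to\mathbb{D}$. Then for all $k\in\mathbb{N}_{a+1}$, $$f\Big(\big[{}_a^{\rm G}\nabla_k^{-\alpha,w(k)}1\big]^{-1}\,{}_a^{\rm G}\nabla_k^{-\alpha,w(k)}x(k)\Big)\le \big[{}_a^{\rm G}\nabla_k^{-\alpha,w(k)}1\big]^{-1}\,{}_a^{\rm G}\nabla_k^{-\alpha,w(k)}f(x(k)).$$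
   Context: For $a\in\mathbb{R}$, $\mathbb{N}_a:=\{a,a+1,a+2,\dots\}$. The rising function is $p^{\overline{q}}:=\frac{\Gamma(p+q)}{\Gamma(p)}$. For $\alpha>0$ and $k\in\mathbb{N}_{a+1}$, the Grünwald–Letnikov fractional sum is ${}_a^{\rm G}\nabla_k^{-\alpha}x(k):=\sum_{j=a+1}^{k}\frac{(k-j+1)^{\overline{\alpha-1}}}{\Gamma(\alpha)}x(j)$, and the tempered sum is ${}_a^{\rm G}\nabla_k^{-\alpha,w(k)}x(k):=w^{-1}(k)\,{}_a^{\rm G}\nabla_k^{-\alpha}[w(k)x(k)]=\sum_{j=a+1}^{k}\frac{(k-j+1)^{\overline{\alpha-1}}}{\Gamma(\alpha)}\frac{w(j)}{w(k)}x(j)$. It acts componentwise on vector-valued sequences; ${}_a^{\rm G}\nabla_k^{-\alpha,w(k)}1$ is the operator applied to the constant sequence $1$. *)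

theory Defs
  imports "HOL-Analysis.Analysis"
begin

text \<open>Functions on \<open>{a, a + 1, a + 2, \<dots>}\<close> are represented by total functions on the reals, of
  which only the values on this set matter.\<close>

definition nats_from :: "real \<Rightarrow> real set" where
  "nats_from a = {a + real i | i. True}"

text \<open>Library \<open>Gamma\<close> is 0 at the non-positive integers and division by 0 is 0.  Below, only
  \<open>p \<ge> 1\<close> and \<open>p + q > 0\<close> occur, where no such value is involved.\<close>

definition rising :: "real \<Rightarrow> real \<Rightarrow> real" where
  "rising p q = Gamma (p + q) / Gamma p"

definition gl_sum :: "real \<Rightarrow> real \<Rightarrow> (real \<Rightarrow> 'b::real_vector) \<Rightarrow> real \<Rightarrow> 'b" where
  "gl_sum a \<alpha> x k =
     (\<Sum>j\<in>{j \<in> nats_from (a + 1). j \<le> k}. (rising (k - j + 1) (\<alpha> - 1) / Gamma \<alpha>) *\<^sub>R x j)"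

definition tempered_gl_sum ::
    "real \<Rightarrow> real \<Rightarrow> (real \<Rightarrow> real) \<Rightarrow> (real \<Rightarrow> 'b::real_vector) \<Rightarrow> real \<Rightarrow> 'b" where
  "tempered_gl_sum a \<alpha> w x k = inverse (w k) *\<^sub>R gl_sum a \<alpha> (\<lambda>j. w j *\<^sub>R x j) k"

lemma nats_from_atMost_eq:
  "{j \<in> nats_from a. j \<le> a + real m} = (\<lambda>i. a + real i) ` {..m}"
  by (auto simp: nats_from_def)

lemma finite_nats_from_atMost: "finite {j \<in> nats_from a. j \<le> k}"
proof (rule finite_subset)
  show "{j \<in> nats_from a. j \<le> k} \<subseteq> (\<lambda>i. a + real i) ` {..nat \<lceil>k - a\<rceil>}"
  proof
    fix j assume "j \<in> {j \<in> nats_from a. j \<le> k}"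
    then obtain i where i: "j = a + real i" "a + real i \<le> k"
      by (auto simp: nats_from_def)
    then have "i \<le> nat \<lceil>k - a\<rceil>" by linarith
    with i show "j \<in> (\<lambda>i. a + real i) ` {..nat \<lceil>k - a\<rceil>}" by auto
  qed
qed auto

lemma tempered_gl_sum_eq:
  "tempered_gl_sum a \<alpha> w x k =
     (\<Sum>j\<in>{j \<in> nats_from (a + 1). j \<le> k}.
        (rising (k - j + 1) (\<alpha> - 1) / Gamma \<alpha> * (w j / w k)) *\<^sub>R x j)"
  by (auto simp: tempered_gl_sum_def gl_sum_def scaleR_sum_right field_simps intro!: sum.cong)

lemma tempered_gl_sum_component:
  fixes x :: "real \<Rightarrow> real ^ 'n"
  shows "tempered_gl_sum a \<alpha> w x k $ i = tempered_gl_sum a \<alpha> w (\<lambda>j. x j $ i) k"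
  by (simp add: tempered_gl_sum_eq)

end

theory Submission
  imports Defs
begin

text \<open>The statement is Jensen's inequality.  At a point \<open>k\<close> the tempered sum is a linear combination
  of the values \<open>x j\<close> with \<open>j \<le> k\<close>, with coefficients that do not depend on \<open>x\<close>, so the sum of the
  constant \<open>1\<close> is the total of these coefficients.  All of them are positive: the Gamma values
  that occur have positive arguments, since \<open>k - j + 1 \<ge> 1\<close> and \<open>k - j + \<alpha> > 0\<close>
  (\<open>gl_kernel_pos\<close>), and \<open>w j / w k\<close> is a quotient of the two positive numbers \<open>w a / w k\<close> and
  \<open>w a / w j\<close>, whether \<open>w\<close> itself is positive or negative.  Dividing by the total, which is positive
  because \<open>j = k\<close> contributes, turns the combination into a convex combination, and the weighted
  form of Jensen's inequality (\<open>convex_on_weighted_mean\<close>) applies to it.\<close>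

lemma convex_on_weighted_mean:
  fixes f :: "'b::real_vector \<Rightarrow> real" and c :: "'i \<Rightarrow> real"
  assumes "finite S" "S \<noteq> {}" "convex_on D f"
    and pos: "\<And>i. i \<in> S \<Longrightarrow> c i > 0"
    and "\<And>i. i \<in> S \<Longrightarrow> y i \<in> D"
  shows "f (inverse (sum c S) *\<^sub>R (\<Sum>i\<in>S. c i *\<^sub>R y i)) \<le> inverse (sum c S) * (\<Sum>i\<in>S. c i * f (y i))"
proof -
  have total: "sum c S > 0"
    using assms by (intro sum_pos) auto
  have "f (\<Sum>i\<in>S. (c i / sum c S) *\<^sub>R y i) \<le> (\<Sum>i\<in>S. c i / sum c S * f (y i))"
  proof (rule convex_on_sum)
    show "(\<Sum>i\<in>S. c i / sum c S) = 1"
      using total by (simp flip: sum_divide_distrib)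
    show "c i / sum c S \<ge> 0" if "i \<in> S" for i
      using total pos[OF that] by simp
  qed (use assms in auto)
  then show ?thesis
    by (simp add: scaleR_sum_right sum_distrib_left divide_inverse mult_ac)
qed

lemma gl_kernel_pos:
  assumes "\<alpha> > 0" "j \<le> k"
  shows "rising (k - j + 1) (\<alpha> - 1) / Gamma \<alpha> > 0"
  using assms by (auto simp: rising_def intro!: divide_pos_pos Gamma_real_pos)

theorem theorem3p17:
  fixes a \<alpha> :: real and w :: "real \<Rightarrow> real"
    and D :: "(real ^ 'n) set" and f :: "real ^ 'n \<Rightarrow> real" and x :: "real \<Rightarrow> real ^ 'n"
  assumes "\<alpha> > 0"
    and "\<And>k. k \<in> nats_from a \<Longrightarrow> w k \<noteq> 0"
    and "\<And>k. k \<in> nats_from (a + 1) \<Longrightarrow> w a / w k > 0"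
    and "convex D"
    and "convex_on D f"
    and "\<And>k. k \<in> nats_from (a + 1) \<Longrightarrow> x k \<in> D"
  shows "\<forall>k \<in> nats_from (a + 1).
    f (inverse (tempered_gl_sum a \<alpha> w (\<lambda>_. 1 :: real) k) *\<^sub>R tempered_gl_sum a \<alpha> w x k)
      \<le> inverse (tempered_gl_sum a \<alpha> w (\<lambda>_. 1 :: real) k) * tempered_gl_sum a \<alpha> w (\<lambda>j. f (x j)) k"
proof
  fix k assume k: "k \<in> nats_from (a + 1)"
  define S where "S = {j \<in> nats_from (a + 1). j \<le> k}"
  define c where "c j = rising (k - j + 1) (\<alpha> - 1) / Gamma \<alpha> * (w j / w k)" for j
  have "finite S"
    unfolding S_def by (rule finite_nats_from_atMost)
  moreover have "S \<noteq> {}"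
    using k by (auto simp: S_def)
  moreover have "c j > 0" if "j \<in> S" for j
  proof -
    have j: "j \<in> nats_from (a + 1)" "j \<le> k"
      using that by (auto simp: S_def)
    have "w j / w k = (w a / w k) / (w a / w j)"
      using assms(3)[OF j(1)] by (auto simp: field_simps)
    then have "w j / w k > 0"
      using assms(3)[OF j(1)] assms(3)[OF k] by (metis divide_pos_pos)
    with gl_kernel_pos[OF \<open>\<alpha> > 0\<close> j(2)] show ?thesis
      unfolding c_def by (rule mult_pos_pos)
  qed
  moreover have "x j \<in> D" if "j \<in> S" for j
    using that assms(6) by (simp add: S_def)
  ultimately have "f (inverse (sum c S) *\<^sub>R (\<Sum>j\<in>S. c j *\<^sub>R x j))
      \<le> inverse (sum c S) * (\<Sum>j\<in>S. c j * f (x j))"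
    using \<open>convex_on D f\<close> by (intro convex_on_weighted_mean)
  then show "f (inverse (tempered_gl_sum a \<alpha> w (\<lambda>_. 1 :: real) k) *\<^sub>R tempered_gl_sum a \<alpha> w x k)
      \<le> inverse (tempered_gl_sum a \<alpha> w (\<lambda>_. 1 :: real) k) * tempered_gl_sum a \<alpha> w (\<lambda>j. f (x j)) k"
    by (simp add: tempered_gl_sum_eq S_def c_def)
qed

end
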